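(* Let $\mathcal H$ be a Hilbert space with scalar product $\langle\cdot,\cdot\rangle$ and norm $\|\cdot\|$. Let $\mathsf L$ and $\mathsf T$ be closed linear operators on $\mathcal H$ such that $\mathsf L-\mathsf T$ generates a strongly continuous semigroup $e^{t(\mathsf L-\mathsf T)}$ on $\mathcal H$. Let $\Pi$ be the orthogonal projection onto the null space $\mathcal N(\mathsf L)$, and let $\mathsf A := \big(1+(\mathsf T\Pi)^*(\mathsf T\Pi)\big)^{-1}(\mathsf T\Pi)^*$. Assume: (i) (microscopic coercivity) $\mathsf L$ is symmetric and there exists $\lambda_m>0$ such that $-\langle \mathsf L f,f\rangle\ge\lambda_m\|(1-\Pi)f\|^2$ for all $f\in\mathcal D(\mathsf L)$; (ii) (macroscopic coercivity) $\mathsf T$ is skew symmetric and there exists $\lambda_M>0$ such that $\|\mathsf T\Pi f\|^2\ge\lambda_M\|\Pi f\|^2$ for all $f\in\mathcal H$ such that $\Pi f\in\mathcal D(\mathsf T)$; (iii) $\Pi\mathsf T\Pi=0$; (iv) the operators $\mathsf A\mathsf T(1-\Pi)$ and $\mathsf A\mathsf L$ are bounded, and there exists a constant $C_M>0$ such that, for all $f\in\mathcal H$, $\|\mathsf A\mathsf T(1-\Pi)f\|+\|\mathsf A\mathsf L f\|\le C_M\|(1-\Pi)f\|$. Then there exist positive constants $\lambda$ and $C$, explicitly computable in terms of $\lambda_m$, $\lambda_M$ and $C_M$ (in particular depending only on these three numbers), such that for every $f_I\in\mathcal H$, $$\big\|e^{t(\mathsf L-\mathsf T)}f_I\big\|\le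 C\,e^{-\lambda t}\,\|f_I\|\qquad\text{for all } t\ge0.$$
   Context: $\mathcal D(\cdot)$ denotes the domain of an operator and $*$ the adjoint with respect to $\langle\cdot,\cdot\rangle$; it is implicit that $\mathsf T\Pi$ (with domain $\{f\in\mathcal H:\Pi f\in\mathcal D(\mathsf T)\}$) is densely defined so that its adjoint makes sense. Skew symmetric means $\langle \mathsf T f,g\rangle=-\langle f,\mathsf T g\rangle$ for $f,g\in\mathcal D(\mathsf T)$. Bounded, densely defined operators are identified with their unique bounded extension to $\mathcal H$; inequalities "for all $f\in\mathcal H$" are understood in this sense.
   Formalization: In (iv), AT(1−Π) is read as AT−ATΠ on D(T), with the bounded operator ATΠ extended to H; with the bare composition on {f : (1−Π)f ∈ D(T)} the constants cannot depend only on the three numbers. The two readings agree when D(T)∩D(TΠ) is a core of T. *)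

theory Defs
  imports "HOL-Analysis.Analysis"
begin

text \<open>
  A (possibly unbounded) operator is represented by its graph, a subset of the product space.
  Its domain is \<^const>\<open>Domain\<close>, its inverse is \<^const>\<open>converse\<close>, and it is a closed operator
  iff the graph is \<^const>\<open>closed\<close> in the product topology. All operations below act on the
  natural domains.
\<close>

type_synonym 'a oper = "('a \<times> 'a) set"

definition linear_oper :: "'a::real_vector oper \<Rightarrow> bool" where
  "linear_oper S \<longleftrightarrow> subspace S \<and> single_valued S"

definition fun_oper :: "('a \<Rightarrow> 'a) \<Rightarrow> 'a oper" where
  "fun_oper P = {(f, P f) | f. True}"

definition oper_comp :: "'a oper \<Rightarrow> 'a oper \<Rightarrow> 'a oper"  (infixr "\<circ>\<^sub>o" 75) where
  "R \<circ>\<^sub>o S = S O R"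

definition oper_add :: "'a::plus oper \<Rightarrow> 'a oper \<Rightarrow> 'a oper"  (infixl "+\<^sub>o" 65) where
  "R +\<^sub>o S = {(f, u + v) | f u v. (f, u) \<in> R \<and> (f, v) \<in> S}"

definition oper_diff :: "'a::minus oper \<Rightarrow> 'a oper \<Rightarrow> 'a oper"  (infixl "-\<^sub>o" 65) where
  "R -\<^sub>o S = {(f, u - v) | f u v. (f, u) \<in> R \<and> (f, v) \<in> S}"

definition null_space :: "'a::zero oper \<Rightarrow> 'a set" where
  "null_space S = {f. (f, 0) \<in> S}"

definition densely_defined :: "'a::topological_space oper \<Rightarrow> bool" where
  "densely_defined S \<longleftrightarrow> closure (Domain S) = UNIV"

definition symmetric_oper :: "'a::real_inner oper \<Rightarrow> bool" where
  "symmetric_oper S \<longleftrightarrow> (\<forall>(f, u) \<in> S. \<forall>(g, v) \<in> S. u \<bullet> g = f \<bullet> v)"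

definition skew_symmetric_oper :: "'a::real_inner oper \<Rightarrow> bool" where
  "skew_symmetric_oper S \<longleftrightarrow> (\<forall>(f, u) \<in> S. \<forall>(g, v) \<in> S. u \<bullet> g = - (f \<bullet> v))"

definition adjoint_oper :: "'a::real_inner oper \<Rightarrow> 'a oper" where
  "adjoint_oper S = {(g, h). \<forall>(f, u) \<in> S. u \<bullet> g = f \<bullet> h}"

definition bounded_oper :: "'a::real_normed_vector oper \<Rightarrow> bool" where
  "bounded_oper S \<longleftrightarrow>
     linear_oper S \<and> densely_defined S \<and> (\<exists>K. \<forall>(f, u) \<in> S. norm u \<le> K * norm f)"

text \<open>
  If \<open>S\<close> satisfies \<^const>\<open>bounded_oper\<close> on a complete space, then the closure of its graph is the
  graph of its unique bounded extension to the whole space.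
\<close>

definition bounded_ext :: "'a::real_normed_vector oper \<Rightarrow> 'a oper" where
  "bounded_ext S = closure S"

definition orthogonal_projection :: "('a::real_inner \<Rightarrow> 'a) \<Rightarrow> 'a set \<Rightarrow> bool" where
  "orthogonal_projection P V \<longleftrightarrow> (\<forall>f. P f \<in> V \<and> f - P f \<in> V\<^sup>\<bottom>)"

definition C0_semigroup :: "(real \<Rightarrow> 'a \<Rightarrow> 'a::real_normed_vector) \<Rightarrow> bool" where
  "C0_semigroup U \<longleftrightarrow>
     (\<forall>t\<ge>0. bounded_linear (U t)) \<and>
     (\<forall>f. U 0 f = f) \<and>
     (\<forall>s\<ge>0. \<forall>t\<ge>0. \<forall>f. U (s + t) f = U s (U t f)) \<and>
     (\<forall>f. ((\<lambda>t. U t f) \<longlongrightarrow> f) (at_right 0))"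

definition semigroup_generator :: "(real \<Rightarrow> 'a \<Rightarrow> 'a::real_normed_vector) \<Rightarrow> 'a oper" where
  "semigroup_generator U = {(f, g). ((\<lambda>t. (U t f - f) /\<^sub>R t) \<longlongrightarrow> g) (at_right 0)}"

text \<open>
  \<open>A = (1 + (T\<Pi>)\<^sup>* (T\<Pi>))\<^sup>-\<^sup>1 (T\<Pi>)\<^sup>*\<close> is a bounded operator on the dense domain of
  \<open>(T\<Pi>)\<^sup>*\<close> and is identified with its extension.
\<close>

definition hypo_A :: "'a::real_inner oper \<Rightarrow> ('a \<Rightarrow> 'a) \<Rightarrow> 'a oper" where
  "hypo_A T P =
     (let S = T \<circ>\<^sub>o fun_oper P
      in bounded_ext ((Id +\<^sub>o adjoint_oper S \<circ>\<^sub>o S)\<inverse> \<circ>\<^sub>o adjoint_oper S))"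

text \<open>
  The operator \<open>A T (1 - \<Pi>)\<close> is read as \<open>A T - A T \<Pi>\<close> on the domain of \<open>T\<close>, where the bounded
  operator \<open>A T \<Pi>\<close> is identified with its extension, so that \<open>\<Pi> f\<close> need not belong to the
  domain of \<open>T\<close> when \<open>f\<close> does. By the lemma below it extends the naive composition restricted to
  the domain of \<open>T\<close>. That composition alone is not enough: it only sees those \<open>f\<close> for which
  \<open>(1 - \<Pi>) f\<close> lies in the domain of \<open>T\<close>, and these need not form a core for \<open>T\<close>. For instance, let
  \<open>T\<close> be differentiation on \<open>L\<^sup>2(-1, 1)\<close> (complex values) with boundary condition
  \<open>f(-1) = exp(i \<theta>) f(1)\<close>, let \<open>\<Pi>\<close> project onto the even functions and let \<open>L = \<Pi> - 1\<close>. With the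
  naive composition all the hypotheses of hypocoercivity hold with constants that do not depend
  on \<open>\<theta>\<close> in \<open>(0, 1)\<close>, while the decay rate degenerates as \<open>\<theta>\<close> tends to \<open>0\<close>.
\<close>

definition hypo_AT_micro :: "'a::real_inner oper \<Rightarrow> ('a \<Rightarrow> 'a) \<Rightarrow> 'a oper" where
  "hypo_AT_micro T P =
     (hypo_A T P \<circ>\<^sub>o T) -\<^sub>o bounded_ext (hypo_A T P \<circ>\<^sub>o T \<circ>\<^sub>o fun_oper P)"

lemma naive_composition_in_hypo_AT_micro:
  assumes T: "subspace T" and A: "subspace (hypo_A T P)" "Domain (hypo_A T P) = UNIV"
    and f: "f \<in> Domain T"
    and fy: "(f, y) \<in> hypo_A T P \<circ>\<^sub>o T \<circ>\<^sub>o fun_oper (\<lambda>g. g - P g)"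
  shows "(f, y) \<in> hypo_AT_micro T P"
proof -
  from fy obtain u where u: "(f - P f, u) \<in> T" "(u, y) \<in> hypo_A T P"
    by (auto simp: oper_comp_def fun_oper_def)
  from f obtain w where w: "(f, w) \<in> T" by auto
  have Pf: "(P f, w - u) \<in> T"
    using subspace_diff[OF T w u(1)] by simp
  obtain z where z: "(w - u, z) \<in> hypo_A T P"
    using A(2) by blast
  have "(w, y + z) \<in> hypo_A T P"
    using subspace_add[OF A(1) u(2) z] by simp
  then have "(f, y + z) \<in> hypo_A T P \<circ>\<^sub>o T"
    using w by (auto simp: oper_comp_def)
  moreover have "(f, z) \<in> hypo_A T P \<circ>\<^sub>o T \<circ>\<^sub>o fun_oper P"
    using Pf z by (auto simp: oper_comp_def fun_oper_def)
  then have "(f, z) \<in> bounded_ext (hypo_A T P \<circ>\<^sub>o T \<circ>\<^sub>o fun_oper P)"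
    unfolding bounded_ext_def using closure_subset by blast
  ultimately have "(f, (y + z) - z) \<in> hypo_AT_micro T P"
    unfolding hypo_AT_micro_def oper_diff_def by blast
  then show ?thesis by simp
qed

text \<open>
  The constants are given by closed formulas because an existential statement inside a theorem
  about a Hilbert space type could not express that they do not depend on the space.
  They come from the entropy \<open>\<parallel>f\<parallel>\<^sup>2 / 2 + \<epsilon> \<langle>A f, f\<rangle>\<close>, which lies between
  \<open>(1 - \<epsilon>) \<parallel>f\<parallel>\<^sup>2 / 2\<close> and \<open>(1 + \<epsilon>) \<parallel>f\<parallel>\<^sup>2 / 2\<close> and dissipates at least
  \<open>\<epsilon> \<mu> \<parallel>f\<parallel>\<^sup>2 / 2\<close>, with \<open>\<mu> = \<lambda>\<^sub>M / (1 + \<lambda>\<^sub>M)\<close>.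
\<close>

definition hypo_eps :: "real \<Rightarrow> real \<Rightarrow> real \<Rightarrow> real" where
  "hypo_eps lm lM CM =
     (let \<mu> = lM / (1 + lM) in min (1 / 2) (lm * \<mu> / (2 * \<mu> + CM\<^sup>2)))"

definition hypo_rate :: "real \<Rightarrow> real \<Rightarrow> real \<Rightarrow> real" where
  "hypo_rate lm lM CM =
     (let \<epsilon> = hypo_eps lm lM CM; \<mu> = lM / (1 + lM) in \<epsilon> * \<mu> / (2 * (1 + \<epsilon>)))"

definition hypo_const :: "real \<Rightarrow> real \<Rightarrow> real \<Rightarrow> real" where
  "hypo_const lm lM CM =
     (let \<epsilon> = hypo_eps lm lM CM in sqrt ((1 + \<epsilon>) / (1 - \<epsilon>)))"

end

theory Submission
  imports Defs
begin

text \<open>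
  Let \<open>S = T \<Pi>\<close>. Along the flow, \<open>\<parallel>f\<parallel>\<^sup>2 / 2\<close> dissipates only the microscopic part \<open>(1 - \<Pi>) f\<close>.
  Adding \<open>\<epsilon> \<langle>A f, f\<rangle>\<close> produces the term \<open>- \<epsilon> \<langle>A T \<Pi> f, f\<rangle>\<close>, and
  \<open>A T \<Pi> = (1 + S\<^sup>*S)\<^sup>-\<^sup>1 S\<^sup>*S\<close> is at least \<open>\<lambda>\<^sub>M / (1 + \<lambda>\<^sub>M)\<close> on the range of \<open>\<Pi>\<close>. The
  other terms contain \<open>(1 - \<Pi>) f\<close> and are absorbed for small \<open>\<epsilon>\<close>: \<open>\<langle>A f, L f\<rangle> = 0\<close> since \<open>A\<close> maps
  into the null space of \<open>L\<close>, and \<open>\<langle>T A f, f\<rangle> \<le> \<parallel>(1 - \<Pi>) f\<parallel>\<^sup>2\<close> since \<open>\<Pi> T \<Pi> = 0\<close>. This is rigorous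
  for \<open>f\<close> in the domain of the generator, which is dense.
\<close>

subsection \<open>Orthogonal projections and the Riesz representation\<close>

text \<open>Completeness replaces compactness: a sequence minimizing the squared distance is Cauchy
  by convexity, and its limit attains the infimum.\<close>

lemma nearest_point_exists:
  fixes V :: "'a::{real_inner, complete_space} set"
  assumes V: "convex V" "closed V" "V \<noteq> {}"
  shows "\<exists>p\<in>V. \<forall>v\<in>V. norm (x - p) \<le> norm (x - v)"
proof -
  define d where "d = (INF v\<in>V. (norm (x - v))\<^sup>2)"
  have bdd: "bdd_below ((\<lambda>v. (norm (x - v))\<^sup>2) ` V)"
    by (rule bdd_belowI2[where m = 0]) simp
  have d: "d \<le> (norm (x - v))\<^sup>2" if "v \<in> V" for v
    unfolding d_def using bdd that by (rule cINF_lower)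
  have "\<exists>v\<in>V. (norm (x - v))\<^sup>2 < d + 1 / real (Suc n)" for n
  proof -
    have "(INF v\<in>V. (norm (x - v))\<^sup>2) < d + 1 / real (Suc n)"
      by (simp flip: d_def)
    then show ?thesis
      unfolding cINF_less_iff[OF V(3) bdd] .
  qed
  then obtain v where v: "\<And>n. v n \<in> V" "\<And>n. (norm (x - v n))\<^sup>2 < d + 1 / real (Suc n)"
    by metis
  \<comment> \<open>The parallelogram identity makes every minimizing sequence Cauchy.\<close>
  have par: "(norm (v m - v n))\<^sup>2 \<le> 2 / real (Suc m) + 2 / real (Suc n)" for m n
  proof -
    have "(1 / 2) *\<^sub>R v m + (1 / 2) *\<^sub>R v n \<in> V"
      using V(1) v(1)[of m] v(1)[of n] by (simp add: convex_def)
    then have "d \<le> (norm (x - ((1 / 2) *\<^sub>R v m + (1 / 2) *\<^sub>R v n)))\<^sup>2"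
      by (rule d)
    also have "(norm (x - ((1 / 2) *\<^sub>R v m + (1 / 2) *\<^sub>R v n)))\<^sup>2
        = (norm (x - v m))\<^sup>2 / 2 + (norm (x - v n))\<^sup>2 / 2 - (norm (v m - v n))\<^sup>2 / 4"
      unfolding power2_norm_eq_inner
      by (simp add: inner_diff_left inner_diff_right inner_add_left inner_add_right
          inner_commute field_simps)
    finally show ?thesis
      using v(2)[of m] v(2)[of n] by (simp add: add_divide_distrib)
  qed
  have "Cauchy v"
  proof (rule metric_CauchyI)
    fix e :: real assume e: "0 < e"
    obtain M where M: "4 / e\<^sup>2 < real M"
      using reals_Archimedean2 by blast
    have small: "2 / real (Suc n) < e\<^sup>2 / 2" if "n \<ge> M" for n
    proof -
      have "4 / e\<^sup>2 < real (Suc n)" using M that by simp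
      then show ?thesis using e by (simp add: field_simps)
    qed
    have "dist (v m) (v n) < e" if "m \<ge> M" "n \<ge> M" for m n
    proof -
      have "(norm (v m - v n))\<^sup>2 < e\<^sup>2"
        using par[of m n] small[OF that(1)] small[OF that(2)] by simp
      then show ?thesis
        using e by (simp add: dist_norm power2_less_imp_less)
    qed
    then show "\<exists>M. \<forall>m\<ge>M. \<forall>n\<ge>M. dist (v m) (v n) < e" by blast
  qed
  then obtain p where p: "v \<longlonglongrightarrow> p"
    using Cauchy_convergent_iff convergent_def by blast
  have "p \<in> V"
    using closed_sequentially[OF V(2)] v(1) p by blast
  moreover have "(norm (x - p))\<^sup>2 \<le> d"
  proof (rule LIMSEQ_le)
    show "(\<lambda>n. (norm (x - v n))\<^sup>2) \<longlonglongrightarrow> (norm (x - p))\<^sup>2"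
      by (intro tendsto_intros p)
    show "(\<lambda>n. d + 1 / real (Suc n)) \<longlonglongrightarrow> d"
      using tendsto_add[OF tendsto_const[of d] LIMSEQ_inverse_real_of_nat]
      by (simp add: inverse_eq_divide)
    show "\<exists>N. \<forall>n\<ge>N. (norm (x - v n))\<^sup>2 \<le> d + 1 / real (Suc n)"
      using v(2) less_imp_le by blast
  qed
  ultimately show ?thesis
    using d by (meson norm_ge_zero order_trans power2_le_imp_le)
qed

lemma orthogonal_projection_exists:
  fixes V :: "'a::{real_inner, complete_space} set"
  assumes V: "subspace V" "closed V"
  shows "\<exists>P. orthogonal_projection P V"
proof -
  have "\<exists>p. p \<in> V \<and> x - p \<in> V\<^sup>\<bottom>" for x
  proof -
    obtain p where p: "p \<in> V" "\<And>v. v \<in> V \<Longrightarrow> norm (x - p) \<le> norm (x - v)"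
      using nearest_point_exists[of V x] V subspace_imp_convex subspace_0 by blast
    have "h \<bullet> (x - p) = 0" if h: "h \<in> V" for h
    proof -
      \<comment> \<open>This \<open>c\<close> minimizes the distance from \<open>x - p\<close> to
        the line spanned by \<open>h\<close>. Since \<open>p\<close> is already nearest, the gain
        \<open>(h \<bullet> (x - p))\<^sup>2 / (h \<bullet> h)\<close> must vanish.\<close>
      define c where "c = (h \<bullet> (x - p)) / (h \<bullet> h)"
      have "p + c *\<^sub>R h \<in> V"
        using V(1) p(1) h by (simp add: subspace_add subspace_scale)
      then have "(norm (x - p))\<^sup>2 \<le> (norm (x - p - c *\<^sub>R h))\<^sup>2"
        using p(2)[of "p + c *\<^sub>R h"] by (simp add: power_mono algebra_simps)
      also have "\<dots> = (norm (x - p))\<^sup>2 - 2 * c * (h \<bullet> (x - p)) + c\<^sup>2 * (h \<bullet> h)"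
        unfolding power2_norm_eq_inner
        by (simp add: inner_diff_left[of "x - p"] inner_diff_right[of _ "x - p"] inner_commute power2_eq_square)
      finally have "2 * c * (h \<bullet> (x - p)) \<le> c\<^sup>2 * (h \<bullet> h)" by simp
      then have "(h \<bullet> (x - p))\<^sup>2 \<le> 0" if "h \<noteq> 0"
        using that by (simp add: c_def power2_eq_square divide_simps mult.assoc)
      then show ?thesis by (cases "h = 0") auto
    qed
    then show ?thesis
      using p(1) by (auto simp: orthogonal_comp_def orthogonal_def)
  qed
  then obtain P where "\<And>x. P x \<in> V \<and> x - P x \<in> V\<^sup>\<bottom>" by metis
  then show ?thesis by (auto simp: orthogonal_projection_def)
qed

context
  fixes P :: "'a::real_inner \<Rightarrow> 'a" and V :: "'a set"
  assumes P: "orthogonal_projection P V" and V: "subspace V"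
begin

lemma projection_in: "P x \<in> V"
  using P by (simp add: orthogonal_projection_def)

lemma projection_orthogonal: "h \<in> V \<Longrightarrow> (x - P x) \<bullet> h = 0"
  using P by (auto simp: orthogonal_projection_def orthogonal_comp_def orthogonal_def inner_commute)

text \<open>Two candidates differ by a vector of \<open>V\<close> orthogonal to itself. This gives
  linearity of \<open>P\<close> and later identifies explicit points of a graph as
  projections.\<close>

lemma projection_unique:
  assumes "p \<in> V" "\<And>h. h \<in> V \<Longrightarrow> (x - p) \<bullet> h = 0"
  shows "P x = p"
proof -
  have "P x - p \<in> V"
    using V projection_in assms(1) by (simp add: subspace_diff)
  then have "(P x - p) \<bullet> (P x - p) = 0"
    using projection_orthogonal[of "P x - p" x] assms(2)[of "P x - p"]
    by (simp add: inner_diff_left)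
  then show ?thesis by simp
qed

lemma projection_eq_self: "x \<in> V \<Longrightarrow> P x = x"
  by (rule projection_unique) auto

lemma projection_idem [simp]: "P (P x) = P x"
  by (simp add: projection_eq_self projection_in)

lemma projection_selfadjoint: "P x \<bullet> y = x \<bullet> P y"
  using projection_orthogonal[OF projection_in[of x], of y]
    projection_orthogonal[OF projection_in[of y], of x]
  by (simp add: inner_diff_left inner_diff_right inner_commute)

lemma projection_pythagoras: "(norm x)\<^sup>2 = (norm (P x))\<^sup>2 + (norm (x - P x))\<^sup>2"
  using projection_orthogonal[OF projection_in[of x], of x]
  unfolding power2_norm_eq_inner by (simp add: inner_diff_left inner_diff_right inner_commute)

lemma norm_projection_le: "norm (P x) \<le> norm x"
  using projection_pythagoras[of x] by (simp add: power2_le_imp_le)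

lemma bounded_linear_projection: "bounded_linear P"
proof (rule bounded_linear_intro[where K = 1])
  show "P (x + y) = P x + P y" for x y
    using projection_orthogonal[of _ x] projection_orthogonal[of _ y]
    by (intro projection_unique subspace_add V projection_in)
      (simp add: inner_diff_left inner_add_left)
  show "P (r *\<^sub>R x) = r *\<^sub>R P x" for r x
    using projection_orthogonal[of _ x]
    by (intro projection_unique subspace_scale V projection_in) (simp add: inner_diff_left)
qed (simp add: norm_projection_le)

end

text \<open>The kernel of a nonzero \<open>\<phi>\<close> is a closed hyperplane, and a vector
  orthogonal to it, suitably scaled, represents \<open>\<phi>\<close>.\<close>

lemma riesz_representation:
  fixes \<phi> :: "'a::{real_inner, complete_space} \<Rightarrow> real"
  assumes "bounded_linear \<phi>"
  shows "\<exists>v. \<forall>x. \<phi> x = v \<bullet> x"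
proof (cases "\<forall>x. \<phi> x = 0")
  case True
  then show ?thesis by (intro exI[of _ 0]) simp
next
  case False
  interpret \<phi>: bounded_linear \<phi> by fact
  define V where "V = {x. \<phi> x = 0}"
  have V: "subspace V" "closed V"
    unfolding V_def
    by (auto simp: subspace_def \<phi>.add \<phi>.scaleR \<phi>.zero
        intro!: closed_Collect_eq continuous_intros \<phi>.continuous_on)
  then obtain P where P: "orthogonal_projection P V"
    using orthogonal_projection_exists by blast
  from False obtain x where x: "\<phi> x \<noteq> 0" by blast
  define e where "e = x - P x"
  have "\<phi> (P x) = 0"
    using projection_in[OF P V(1)] by (simp add: V_def)
  then have e: "\<phi> e \<noteq> 0"
    using x by (simp add: e_def \<phi>.diff)
  then have ne: "e \<bullet> e \<noteq> 0"
    using \<phi>.zero by auto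
  have "\<phi> y = (\<phi> e / (e \<bullet> e)) *\<^sub>R e \<bullet> y" for y
  proof -
    have "y - (\<phi> y / \<phi> e) *\<^sub>R e \<in> V"
      using e by (simp add: V_def \<phi>.diff \<phi>.scaleR)
    then have "e \<bullet> (y - (\<phi> y / \<phi> e) *\<^sub>R e) = 0"
      unfolding e_def by (rule projection_orthogonal[OF P V(1)])
    then show ?thesis
      using e ne by (simp add: inner_diff_right field_simps)
  qed
  then show ?thesis by blast
qed

subsection \<open>Integration in a Hilbert space\<close>

text \<open>
  The library integrates continuous functions with values in the class \<^class>\<open>banach\<close>, to
  which the sort of the theorem does not belong formally. The dual space does, and it is
  identified with the space by the Riesz representation.
\<close>

lemma hilbert_antiderivative:
  fixes f :: "real \<Rightarrow> 'a::{real_inner, complete_space}"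
  assumes "continuous_on {a..b} f"
  shows "\<exists>F. \<forall>t\<in>{a..b}. (F has_vector_derivative f t) (at t within {a..b})"
proof -
  have "\<exists>v. \<forall>x. blinfun_apply \<phi> x = v \<bullet> x" for \<phi> :: "'a \<Rightarrow>\<^sub>L real"
    by (rule riesz_representation) (rule blinfun.bounded_linear_right)
  then obtain R where R: "\<And>(\<phi> :: 'a \<Rightarrow>\<^sub>L real) x. blinfun_apply \<phi> x = R \<phi> \<bullet> x"
    by metis
  have R_eqI: "R \<phi> = v" if "\<And>x. blinfun_apply \<phi> x = v \<bullet> x" for \<phi> v
  proof -
    have "R \<phi> \<bullet> x = v \<bullet> x" for x using that[of x] by (simp add: R)
    then show ?thesis using vector_eq_rdot by blast
  qed
  have R_bl: "bounded_linear R"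
  proof (rule bounded_linear_intro[where K = 1])
    show "R (\<phi> + \<psi>) = R \<phi> + R \<psi>" for \<phi> \<psi>
      by (rule R_eqI) (simp add: inner_add_left blinfun.add_left flip: R)
    show "R (r *\<^sub>R \<phi>) = r *\<^sub>R R \<phi>" for r \<phi>
      by (rule R_eqI) (simp add: blinfun.scaleR_left flip: R)
    show "norm (R \<phi>) \<le> norm \<phi> * 1" for \<phi>
    proof -
      have "norm (R \<phi>) * norm (R \<phi>) \<le> norm \<phi> * norm (R \<phi>)"
        using norm_blinfun[of \<phi> "R \<phi>"] R[of \<phi> "R \<phi>"] norm_eq_square[of "R \<phi>"]
        by (simp add: power2_norm_eq_inner[symmetric] power2_eq_square)
      then show ?thesis by (cases "R \<phi> = 0") simp_all
    qed
  qed
  \<comment> \<open>\<open>R\<close> undoes the embedding into the dual, so it carries an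
    antiderivative of the embedded function back to one of \<open>f\<close>.\<close>
  have J: "R (blinfun_inner_right v) = v" for v
    by (rule R_eqI) simp
  have "continuous_on {a..b} (\<lambda>t. blinfun_inner_right (f t))"
    by (rule bounded_linear.continuous_on[OF bounded_linear_blinfun_inner_right assms])
  then obtain G where G: "\<And>t. t \<in> {a..b} \<Longrightarrow>
      (G has_vector_derivative blinfun_inner_right (f t)) (at t within {a..b})"
    using antiderivative_continuous by blast
  have "((\<lambda>t. R (G t)) has_vector_derivative f t) (at t within {a..b})" if "t \<in> {a..b}" for t
    using bounded_linear.has_vector_derivative[OF R_bl G[OF that]] by (simp add: J)
  then show ?thesis by blast
qed

subsection \<open>Strongly continuous semigroups\<close>

text \<open>By Baire, one of the closed sets \<open>E n\<close> contains a ball; differences of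
  points of that ball reach every direction.\<close>

lemma uniform_boundedness:
  fixes F :: "'i \<Rightarrow> 'a::{real_normed_vector, complete_space} \<Rightarrow> 'b::real_normed_vector"
  assumes F: "\<And>i. bounded_linear (F i)"
    and bounded: "\<And>x. \<exists>K. \<forall>i. norm (F i x) \<le> K"
  shows "\<exists>K. \<forall>i x. norm (F i x) \<le> K * norm x"
proof -
  define E where "E n = {x. \<forall>i. norm (F i x) \<le> real n}" for n
  have closed: "closed (E n)" for n
    unfolding E_def
    by (intro closed_Collect_all closed_Collect_le continuous_intros
        bounded_linear.continuous_on[OF F])
  have cover: "(\<Union>n. E n) = UNIV"
  proof -
    have "x \<in> (\<Union>n. E n)" for x
    proof -
      obtain K where K: "\<And>i. norm (F i x) \<le> K" using bounded by blast
      obtain n where "K \<le> real n" using real_arch_simple by blast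
      then have "x \<in> E n" unfolding E_def using K order_trans by blast
      then show ?thesis by blast
    qed
    then show ?thesis by blast
  qed
  have "\<exists>n. interior (E n) \<noteq> {}"
  proof (rule ccontr)
    assume "\<not> ?thesis"
    then have "euclidean interior_of (\<Union>(range E)) = {}"
      by (intro Baire_category_alt) (auto simp: closed completely_metrizable_space_euclidean)
    then show False using cover by simp
  qed
  then obtain n a where "a \<in> interior (E n)" by blast
  then obtain r where r: "r > 0" "cball a r \<subseteq> E n"
    using open_contains_cball interior_subset open_interior by (metis subset_trans)
  have "norm (F i x) \<le> (2 * real n / r) * norm x" for i x
  proof (cases "x = 0")
    case True
    then show ?thesis by (simp add: linear_simps(3)[OF F])
  next
    case False
    define c where "c = r / norm x"
    have c: "c > 0" using r(1) False by (simp add: c_def)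
    have "a + c *\<^sub>R x \<in> E n" "a \<in> E n"
      using r False by (auto simp: dist_norm c_def intro!: subsetD[OF r(2)])
    then have le: "norm (F i (a + c *\<^sub>R x)) \<le> real n" "norm (F i a) \<le> real n"
      by (auto simp: E_def)
    have "c * norm (F i x) = norm (F i (a + c *\<^sub>R x) - F i a)"
      using c by (simp add: linear_simps[OF F])
    also have "\<dots> \<le> 2 * real n"
      using norm_triangle_ineq4[of "F i (a + c *\<^sub>R x)" "F i a"] le by linarith
    finally show ?thesis
      using r(1) False by (simp add: c_def field_simps)
  qed
  then show ?thesis by blast
qed

text \<open>Links the calculus of derivatives to generators, which are defined by difference
  quotients.\<close>

lemma has_vector_derivative_within_iff_quotient:
  fixes F :: "real \<Rightarrow> 'a::real_normed_vector"
  shows "(F has_vector_derivative D) (at x within S) \<longleftrightarrow>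
    ((\<lambda>y. (F y - F x) /\<^sub>R (y - x)) \<longlongrightarrow> D) (at x within S)"
proof -
  have "norm ((F y - F x) /\<^sub>R (y - x) - D) = norm (F y - F x - (y - x) *\<^sub>R D) / norm (y - x)"
    if "y \<noteq> x" for y
  proof -
    have "(F y - F x) /\<^sub>R (y - x) - D = (F y - F x - (y - x) *\<^sub>R D) /\<^sub>R (y - x)"
      using that by (simp add: scaleR_diff_right)
    then show ?thesis by (simp add: divide_inverse mult.commute)
  qed
  then have "((\<lambda>y. norm ((F y - F x) /\<^sub>R (y - x) - D)) \<longlongrightarrow> 0) (at x within S) \<longleftrightarrow>
      ((\<lambda>y. norm (F y - F x - (y - x) *\<^sub>R D) / norm (y - x)) \<longlongrightarrow> 0) (at x within S)"
    by (intro filterlim_cong) (auto simp: eventually_at_filter)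
  moreover have "((\<lambda>y. (F y - F x) /\<^sub>R (y - x)) \<longlongrightarrow> D) (at x within S) \<longleftrightarrow>
      ((\<lambda>y. norm ((F y - F x) /\<^sub>R (y - x) - D)) \<longlongrightarrow> 0) (at x within S)"
    by (subst Lim_null) (simp only: tendsto_norm_zero_iff)
  ultimately show ?thesis
    by (simp add: has_vector_derivative_def has_derivative_iff_norm bounded_linear_scaleR_left)
qed

text \<open>Lets a right limit at time \<open>0\<close> control limits from both sides at time
  \<open>s\<close>.\<close>

lemma filterlim_abs_diff_at_right:
  "filterlim (\<lambda>y::real. \<bar>y - s\<bar>) (at_right 0) (at s within S)"
proof -
  have "((\<lambda>y. \<bar>y - s\<bar>) \<longlongrightarrow> \<bar>s - s\<bar>) (at s within S)"
    by (intro tendsto_intros)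
  then show ?thesis
    by (auto simp: filterlim_at eventually_at_filter)
qed

context
  fixes U :: "real \<Rightarrow> 'a::{real_normed_vector, complete_space} \<Rightarrow> 'a"
  assumes U: "C0_semigroup U"
begin

lemma semigroup_bounded_linear: "t \<ge> 0 \<Longrightarrow> bounded_linear (U t)"
  and semigroup_zero: "U 0 f = f"
  and semigroup_add: "s \<ge> 0 \<Longrightarrow> t \<ge> 0 \<Longrightarrow> U (s + t) f = U s (U t f)"
  and semigroup_tendsto: "((\<lambda>t. U t f) \<longlongrightarrow> f) (at_right 0)"
  using U by (auto simp: C0_semigroup_def)

text \<open>Otherwise the operator norms are unbounded along some times tending to \<open>0\<close>,
  although every orbit converges along them. This contradicts uniform boundedness.\<close>

lemma semigroup_bounded_near_zero:
  "\<exists>\<delta>>0. \<exists>K. \<forall>t\<in>{0..\<delta>}. \<forall>f. norm (U t f) \<le> K * norm f"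
proof (rule ccontr)
  assume neg: "\<not> ?thesis"
  have "\<exists>t\<in>{0..1 / real (Suc n)}. \<exists>f. real n * norm f < norm (U t f)" for n
  proof -
    have "0 < 1 / real (Suc n)" by simp
    with neg show ?thesis by (meson not_le)
  qed
  then obtain t f where t: "\<And>n. t n \<in> {0..1 / real (Suc n)}"
    and f: "\<And>n. real n * norm (f n) < norm (U (t n) (f n))"
    by metis
  have t0: "t \<longlonglongrightarrow> 0"
  proof (rule tendsto_sandwich[where f = "\<lambda>_. 0" and h = "\<lambda>n. 1 / real (Suc n)"])
    show "(\<lambda>n. 1 / real (Suc n)) \<longlonglongrightarrow> 0"
      using LIMSEQ_inverse_real_of_nat by (simp add: inverse_eq_divide)
  qed (use t in \<open>auto intro!: always_eventually\<close>)
  have "\<exists>K. \<forall>n. norm (U (t n) x) \<le> K" for x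
  proof -
    have "continuous (at 0 within {0..}) (\<lambda>t. U t x)"
      using semigroup_tendsto by (simp add: continuous_within semigroup_zero at_within_Ici_at_right)
    then have "((\<lambda>t. U t x) \<circ> t) \<longlonglongrightarrow> U 0 x"
      using t t0 by (auto simp: continuous_within_sequentially)
    then have "convergent (\<lambda>n. U (t n) x)"
      by (auto simp: convergent_def o_def)
    then show ?thesis
      by (meson Bseq_def convergent_imp_Bseq)
  qed
  moreover have "bounded_linear (U (t n))" for n
    using t by (simp add: semigroup_bounded_linear)
  ultimately obtain K where K: "\<And>n x. norm (U (t n) x) \<le> K * norm x"
    using uniform_boundedness[of "\<lambda>n. U (t n)"] by blast
  obtain n where "K \<le> real n" using real_arch_simple by blast
  then have "K * norm (f n) \<le> real n * norm (f n)" by (simp add: mult_right_mono)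
  with f[of n] K[of n "f n"] show False by linarith
qed

lemma semigroup_locally_bounded:
  "\<exists>K\<ge>0. \<forall>t\<in>{0..b}. \<forall>f. norm (U t f) \<le> K * norm f"
proof -
  obtain \<delta> K0 where \<delta>: "\<delta> > 0" and K0: "\<And>t f. t \<in> {0..\<delta>} \<Longrightarrow> norm (U t f) \<le> K0 * norm f"
    using semigroup_bounded_near_zero by blast
  define M where "M = max 1 K0"
  have M: "norm (U t f) \<le> M * norm f" if "t \<in> {0..\<delta>}" for t f
    using K0[OF that, of f] mult_right_mono[of K0 M "norm f"] by (simp add: M_def)
  have M1: "M \<ge> 1" by (simp add: M_def)
  have power: "\<forall>t\<in>{0..real n * \<delta>}. \<forall>f. norm (U t f) \<le> M ^ n * norm f" for n
  proof (induction n)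
    case 0
    then show ?case by (simp add: semigroup_zero)
  next
    case (Suc n)
    show ?case
    proof (intro ballI allI)
      fix t f assume t: "t \<in> {0..real (Suc n) * \<delta>}"
      \<comment> \<open>One step of length at most \<open>\<delta>\<close> is split off; what
        remains lies in the interval of the induction hypothesis.\<close>
      define s where "s = min t \<delta>"
      have s: "s \<in> {0..\<delta>}" "t - s \<in> {0..real n * \<delta>}"
        using t \<delta> by (auto simp: s_def min_def algebra_simps)
      have "norm (U t f) = norm (U (t - s) (U s f))"
        using semigroup_add[of "t - s" s f] s by simp
      also have "\<dots> \<le> M ^ n * norm (U s f)"
        using Suc s(2) by blast
      also have "\<dots> \<le> M ^ n * (M * norm f)"
        using M[OF s(1)] M1 by (simp add: mult_left_mono)
      finally show "norm (U t f) \<le> M ^ Suc n * norm f"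
        by (simp add: mult_ac)
    qed
  qed
  obtain n where "b \<le> real n * \<delta>"
    using \<delta> by (metis reals_Archimedean3 less_imp_le)
  then have "\<forall>t\<in>{0..b}. \<forall>f. norm (U t f) \<le> M ^ n * norm f"
    using power[of n] by auto
  moreover have "M ^ n \<ge> 0" using M1 by simp
  ultimately show ?thesis by blast
qed

text \<open>Pulling out \<open>U\<close> at the smaller of two times leaves the increment
  \<open>U \<bar>t - s\<bar> f - f\<close>, which is small by continuity at \<open>0\<close>. The
  local bound controls the factor, also for left limits.\<close>

lemma semigroup_continuous: "continuous_on {0..} (\<lambda>t. U t f)"
  unfolding continuous_on
proof
  fix s :: real assume s: "s \<in> {0..}"
  obtain K where K: "K \<ge> 0" "\<And>t f. t \<in> {0..s + 1} \<Longrightarrow> norm (U t f) \<le> K * norm f"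
    using semigroup_locally_bounded by blast
  have "norm (U t f - U s f) \<le> K * norm (U \<bar>t - s\<bar> f - f)" if "t \<in> {0..s + 1}" for t
  proof -
    define m where "m = min t s"
    have m: "m \<in> {0..s + 1}" using that s by (auto simp: m_def)
    have "norm (U t f - U s f) = norm (U m (U \<bar>t - s\<bar> f - f))"
    proof (cases "t \<le> s")
      case True
      then show ?thesis
        using semigroup_add[of t "s - t" f] that
        by (simp add: m_def linear_simps(2)[OF semigroup_bounded_linear] norm_minus_commute)
    next
      case False
      then show ?thesis
        using semigroup_add[of s "t - s" f] s
        by (simp add: m_def linear_simps(2)[OF semigroup_bounded_linear])
    qed
    then show ?thesis using K(2)[OF m] by simp
  qed
  then have "\<forall>\<^sub>F t in at s within {0..}. norm (U t f - U s f) \<le> K * norm (U \<bar>t - s\<bar> f - f)"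
    by (auto simp: eventually_at dist_real_def intro!: exI[of _ 1])
  moreover have "((\<lambda>t. K * norm (U \<bar>t - s\<bar> f - f)) \<longlongrightarrow> K * norm (f - f)) (at s within {0..})"
    by (intro tendsto_intros
        filterlim_compose[OF semigroup_tendsto filterlim_abs_diff_at_right])
  ultimately have "((\<lambda>t. U t f - U s f) \<longlongrightarrow> 0) (at s within {0..})"
    by (elim Lim_null_comparison tendsto_eq_rhs) simp
  then show "((\<lambda>t. U t f) \<longlongrightarrow> U s f) (at s within {0..})"
    by (rule LIM_zero_cancel)
qed

lemma semigroup_generator_invariant:
  assumes "(f, g) \<in> semigroup_generator U" and t: "t \<ge> 0"
  shows "(U t f, U t g) \<in> semigroup_generator U"
proof -
  interpret bounded_linear "U t"
    using t by (rule semigroup_bounded_linear)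
  have "((\<lambda>h. U t ((U h f - f) /\<^sub>R h)) \<longlongrightarrow> U t g) (at_right 0)"
    using assms(1) by (intro tendsto) (simp add: semigroup_generator_def)
  moreover have "\<forall>\<^sub>F h in at_right 0. U t ((U h f - f) /\<^sub>R h) = (U h (U t f) - U t f) /\<^sub>R h"
  proof -
    have "U t ((U h f - f) /\<^sub>R h) = (U h (U t f) - U t f) /\<^sub>R h" if "h > 0" for h
      using semigroup_add[of t h f] semigroup_add[of h t f] t that
      by (simp add: scaleR diff add.commute)
    then show ?thesis by (auto simp: eventually_at_filter)
  qed
  ultimately have "((\<lambda>h. (U h (U t f) - U t f) /\<^sub>R h) \<longlongrightarrow> U t g) (at_right 0)"
    by (rule Lim_transform_eventually)
  then show ?thesis by (simp add: semigroup_generator_def)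
qed

text \<open>The generator only knows the right quotient at \<open>0\<close>. Pulling out
  \<open>U\<close> at the smaller time expresses both one-sided quotients at \<open>t\<close>
  through it; on the left that time varies, which costs the term
  \<open>norm (U (min y t) g - U t g)\<close>.\<close>

lemma semigroup_has_vector_derivative:
  assumes fg: "(f, g) \<in> semigroup_generator U" and t: "t \<ge> 0"
  shows "((\<lambda>t. U t f) has_vector_derivative U t g) (at t within {0..})"
proof -
  define q where "q h = (U h f - f) /\<^sub>R h" for h
  have q: "(q \<longlongrightarrow> g) (at_right 0)"
    using fg by (simp add: semigroup_generator_def q_def[abs_def])
  obtain K where K: "K \<ge> 0" "\<And>s f. s \<in> {0..t} \<Longrightarrow> norm (U s f) \<le> K * norm f"
    using semigroup_locally_bounded by blast
  have "norm ((U y f - U t f) /\<^sub>R (y - t) - U t g)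
      \<le> K * norm (q \<bar>y - t\<bar> - g) + norm (U (min y t) g - U t g)" if y: "y \<ge> 0" "y \<noteq> t" for y
  proof -
    define m where "m = min y t"
    have m: "m \<in> {0..t}" using y t by (auto simp: m_def)
    interpret bounded_linear "U m"
      using m by (intro semigroup_bounded_linear) simp
    have "(U y f - U t f) /\<^sub>R (y - t) = U m (q \<bar>y - t\<bar>)"
    proof (cases "y > t")
      case True
      then show ?thesis
        using semigroup_add[of m "y - t" f] m by (simp add: m_def q_def linear_simps[OF semigroup_bounded_linear])
    next
      case False
      then have "U m (q \<bar>y - t\<bar>) = (U t f - U y f) /\<^sub>R (t - y)"
        using semigroup_add[of m "t - y" f] m y by (simp add: m_def q_def linear_simps[OF semigroup_bounded_linear])
      also have "\<dots> = (U y f - U t f) /\<^sub>R (y - t)"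
        using scaleR_minus_left[of "inverse (y - t)" "U t f - U y f"] inverse_minus_eq[of "y - t"]
        by (simp add: scaleR_diff_right)
      finally show ?thesis by simp
    qed
    then have "(U y f - U t f) /\<^sub>R (y - t) - U t g = U m (q \<bar>y - t\<bar> - g) + (U m g - U t g)"
      by (simp add: diff)
    then have "norm ((U y f - U t f) /\<^sub>R (y - t) - U t g)
        \<le> norm (U m (q \<bar>y - t\<bar> - g)) + norm (U m g - U t g)"
      by (metis norm_triangle_ineq)
    with K(2)[OF m, of "q \<bar>y - t\<bar> - g"] show ?thesis by (simp add: m_def)
  qed
  then have "\<forall>\<^sub>F y in at t within {0..}. norm ((U y f - U t f) /\<^sub>R (y - t) - U t g)
      \<le> K * norm (q \<bar>y - t\<bar> - g) + norm (U (min y t) g - U t g)"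
    by (auto simp: eventually_at_filter)
  moreover have "((\<lambda>y. K * norm (q \<bar>y - t\<bar> - g) + norm (U (min y t) g - U t g))
      \<longlongrightarrow> K * norm (g - g) + norm (U (min t t) g - U t g)) (at t within {0..})"
  proof (intro tendsto_intros filterlim_compose[OF q filterlim_abs_diff_at_right])
    have "continuous_on {0..} (\<lambda>y. U (min y t) g)"
      using t by (intro continuous_on_compose2[OF semigroup_continuous] continuous_intros) auto
    then show "((\<lambda>y. U (min y t) g) \<longlongrightarrow> U (min t t) g) (at t within {0..})"
      using t by (auto simp: continuous_on dest!: bspec[where x = t])
  qed
  ultimately have "((\<lambda>y. (U y f - U t f) /\<^sub>R (y - t) - U t g) \<longlongrightarrow> 0) (at t within {0..})"
    by (elim Lim_null_comparison tendsto_eq_rhs) simp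
  then show ?thesis
    unfolding has_vector_derivative_within_iff_quotient by (rule LIM_zero_cancel)
qed

end

section \<open>Density of the domain of a generator\<close>

lemma filterlim_shift_at_right:
  assumes "0 \<le> t" "t < b"
  shows "filterlim (\<lambda>h::real. t + h) (at t within {0..b}) (at_right 0)"
proof -
  have "((\<lambda>h. t + h) \<longlongrightarrow> t + 0) (at_right 0)"
    by (intro tendsto_intros)
  moreover have "\<forall>\<^sub>F h in at_right 0. h < b - t"
    using assms by (simp add: eventually_at_right_less order_tendstoD(2)[OF tendsto_ident_at])
  then have "\<forall>\<^sub>F h in at_right 0. t + h \<in> {0..b} \<and> t + h \<noteq> t"
    using eventually_at_right_less[of 0]
    by eventually_elim (use assms in auto)
  ultimately show ?thesis by (simp add: filterlim_at)
qed

text \<open>The averages of the orbit of \<open>f\<close> over \<open>[0, t]\<close> lie in the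
  domain and tend to \<open>f\<close> as \<open>t\<close> tends to \<open>0\<close>.\<close>

lemma semigroup_generator_dense:
  fixes U :: "real \<Rightarrow> 'a::{real_inner, complete_space} \<Rightarrow> 'a"
  assumes U: "C0_semigroup U"
  shows "densely_defined (semigroup_generator U)"
proof -
  have "f \<in> closure (Domain (semigroup_generator U))" for f
  proof -
    \<comment> \<open>Length \<open>2\<close> leaves room for \<open>t + h\<close> with both
      \<open>t\<close> and \<open>h\<close> in \<open>[0, 1]\<close>.\<close>
    have "continuous_on {0..2} (\<lambda>t. U t f)"
      using semigroup_continuous[OF U] by (rule continuous_on_subset) auto
    then obtain V where V: "\<And>t. t \<in> {0..2} \<Longrightarrow>
        (V has_vector_derivative U t f) (at t within {0..2})"
      using hilbert_antiderivative by blast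
    have small: "\<forall>\<^sub>F h in at_right (0::real). h \<in> {0<..1}"
      by (auto simp: eventually_at_right_field intro!: exI[of _ 1])
    have quot: "((\<lambda>h. (V (t + h) - V t) /\<^sub>R h) \<longlongrightarrow> U t f) (at_right 0)" if "t \<in> {0..1}" for t
      using filterlim_compose[OF _ filterlim_shift_at_right, of _ _ t 2] V[of t] that
      by (fastforce simp: has_vector_derivative_within_iff_quotient)
    \<comment> \<open>\<open>U h\<close> commutes with integration along the orbit: as functions of
      \<open>t\<close>, both sides vanish at \<open>0\<close> and have derivative
      \<open>U (t + h) f\<close>.\<close>
    have shift: "U h (V t - V 0) = V (t + h) - V h" if h: "h \<in> {0..1}" and t: "t \<in> {0..1}" for h t
    proof -
      have "bounded_linear (U h)"
        using h semigroup_bounded_linear[OF U] by simp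
      note Uh = bounded_linear.has_vector_derivative[OF this]
      have "((\<lambda>t. U h (V t - V 0) - (V (t + h) - V h)) has_vector_derivative 0) (at t within {0..1})"
        if t: "t \<in> {0..1}" for t
      proof -
        have "(V has_vector_derivative U t f) (at t within {0..1})"
          using V[of t] t by (auto intro: has_vector_derivative_within_subset)
        then have "((\<lambda>t. V t - V 0) has_vector_derivative U t f - 0) (at t within {0..1})"
          by (intro derivative_intros)
        from Uh[OF this]
        have 1: "((\<lambda>t. U h (V t - V 0)) has_vector_derivative U h (U t f)) (at t within {0..1})"
          by simp
        have "((\<lambda>t. t + h) has_vector_derivative 1 + 0) (at t within {0..1})"
          by (intro derivative_intros)
        moreover have "(V has_vector_derivative U (t + h) f) (at (t + h) within (\<lambda>t. t + h) ` {0..1})"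
          using V[of "t + h"] t h by (auto intro!: has_vector_derivative_within_subset[where S = "{0..2}"])
        ultimately have "(V \<circ> (\<lambda>t. t + h) has_vector_derivative (1 + 0) *\<^sub>R U (t + h) f) (at t within {0..1})"
          by (rule vector_diff_chain_within)
        then have "((\<lambda>t. V (t + h) - V h) has_vector_derivative U (t + h) f - 0) (at t within {0..1})"
          by (intro derivative_intros) (simp add: o_def)
        from has_vector_derivative_diff[OF 1 this]
        show ?thesis
          using semigroup_add[OF U, of h t f] h t by (simp add: add.commute)
      qed
      then have "((\<lambda>t. U h (V t - V 0) - (V (t + h) - V h)) has_derivative (\<lambda>h. 0)) (at t within {0..1})"
        if "t \<in> {0..1}" for t
        using that by (auto simp: has_vector_derivative_def)
      then have "U h (V t - V 0) - (V (t + h) - V h) = U h (V 0 - V 0) - (V (0 + h) - V h)"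
        using t by (intro has_derivative_zero_unique[where s = "{0..1::real}"]) auto
      also have "\<dots> = 0"
        using \<open>bounded_linear (U h)\<close> by (simp add: linear_simps)
      finally show ?thesis by simp
    qed
    have gen: "(V t - V 0, U t f - f) \<in> semigroup_generator U" if t: "t \<in> {0..1}" for t
    proof -
      \<comment> \<open>By \<open>shift\<close>, the increment of \<open>V t - V 0\<close> under
        \<open>U h\<close> is the integral over \<open>[t, t + h]\<close> minus the one over
        \<open>[0, h]\<close>.\<close>
      have "((\<lambda>h. (V (t + h) - V t) /\<^sub>R h - (V (0 + h) - V 0) /\<^sub>R h) \<longlongrightarrow> U t f - U 0 f) (at_right 0)"
        by (intro tendsto_diff quot) (use t in auto)
      moreover have "\<forall>\<^sub>F h in at_right 0. (V (t + h) - V t) /\<^sub>R h - (V (0 + h) - V 0) /\<^sub>R h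
          = (U h (V t - V 0) - (V t - V 0)) /\<^sub>R h"
        using small by eventually_elim (use t in \<open>simp add: shift flip: scaleR_diff_right\<close>)
      ultimately have "((\<lambda>h. (U h (V t - V 0) - (V t - V 0)) /\<^sub>R h) \<longlongrightarrow> U t f - U 0 f) (at_right 0)"
        by (rule Lim_transform_eventually)
      then show ?thesis by (simp add: semigroup_generator_def semigroup_zero[OF U])
    qed
    have "(c *\<^sub>R w, c *\<^sub>R g) \<in> semigroup_generator U" if "(w, g) \<in> semigroup_generator U" for c w g
    proof -
      have "((\<lambda>h. c *\<^sub>R ((U h w - w) /\<^sub>R h)) \<longlongrightarrow> c *\<^sub>R g) (at_right 0)"
        using that by (intro tendsto_intros) (simp add: semigroup_generator_def)
      moreover have "\<forall>\<^sub>F h in at_right 0. c *\<^sub>R ((U h w - w) /\<^sub>R h) = (U h (c *\<^sub>R w) - c *\<^sub>R w) /\<^sub>R h"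
        using eventually_at_right_less[of 0]
        by eventually_elim
          (simp add: linear_simps[OF semigroup_bounded_linear[OF U]] scaleR_diff_right mult.commute)
      ultimately have "((\<lambda>h. (U h (c *\<^sub>R w) - c *\<^sub>R w) /\<^sub>R h) \<longlongrightarrow> c *\<^sub>R g) (at_right 0)"
        by (rule Lim_transform_eventually)
      then show ?thesis by (simp add: semigroup_generator_def)
    qed
    then have dom: "(V t - V 0) /\<^sub>R t \<in> Domain (semigroup_generator U)" if "t \<in> {0..1}" for t
      using gen[OF that] by blast
    have "\<forall>\<^sub>F t in at_right 0. (V (0 + t) - V 0) /\<^sub>R t \<in> closure (Domain (semigroup_generator U))"
      using small by eventually_elim (use dom in \<open>auto intro: subsetD[OF closure_subset]\<close>)
    then have "U 0 f \<in> closure (Domain (semigroup_generator U))"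
      by (rule Lim_in_closed_set[OF closed_closure _ _ quot]) auto
    then show ?thesis by (simp add: semigroup_zero[OF U])
  qed
  then show ?thesis by (auto simp: densely_defined_def)
qed

subsection \<open>Entropy decay along a semigroup\<close>

text \<open>A Gronwall argument for the modified entropy \<open>H\<close>, whose equivalence with
  the squared norm produces the constant in front of the exponential.\<close>

lemma semigroup_entropy_decay:
  fixes U :: "real \<Rightarrow> 'a::{real_inner, complete_space} \<Rightarrow> 'a"
  assumes U: "C0_semigroup U" and A: "bounded_linear A"
    and \<epsilon>: "0 \<le> \<epsilon>" "\<epsilon> < 1"
    and A_bound: "\<And>f. \<bar>A f \<bullet> f\<bar> \<le> (norm f)\<^sup>2 / 2"
    and r: "r \<ge> 0"
    and dissipation: "\<And>f g. (f, g) \<in> semigroup_generator U \<Longrightarrow>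
      g \<bullet> f + \<epsilon> * (A g \<bullet> f + A f \<bullet> g) \<le> - (r * (1 + \<epsilon>) * (norm f)\<^sup>2)"
    and t: "t \<ge> 0"
  shows "norm (U t f) \<le> sqrt ((1 + \<epsilon>) / (1 - \<epsilon>)) * exp (- r * t) * norm f"
proof -
  define H where "H f = (norm f)\<^sup>2 / 2 + \<epsilon> * (A f \<bullet> f)" for f
  have H_bounds: "(1 - \<epsilon>) / 2 * (norm f)\<^sup>2 \<le> H f" "H f \<le> (1 + \<epsilon>) / 2 * (norm f)\<^sup>2" for f
  proof -
    have "\<epsilon> * \<bar>A f \<bullet> f\<bar> \<le> \<epsilon> * ((norm f)\<^sup>2 / 2)"
      using \<epsilon>(1) A_bound by (rule mult_left_mono[rotated])
    then have "\<bar>\<epsilon> * (A f \<bullet> f)\<bar> \<le> \<epsilon> * ((norm f)\<^sup>2 / 2)"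
      using \<epsilon>(1) by (simp add: abs_mult)
    then have "(norm f)\<^sup>2 / 2 - \<epsilon> * ((norm f)\<^sup>2 / 2) \<le> H f"
      "H f \<le> (norm f)\<^sup>2 / 2 + \<epsilon> * ((norm f)\<^sup>2 / 2)"
      unfolding H_def abs_le_iff by simp_all
    moreover have "(1 - \<epsilon>) / 2 * (norm f)\<^sup>2 = (norm f)\<^sup>2 / 2 - \<epsilon> * ((norm f)\<^sup>2 / 2)"
      "(1 + \<epsilon>) / 2 * (norm f)\<^sup>2 = (norm f)\<^sup>2 / 2 + \<epsilon> * ((norm f)\<^sup>2 / 2)"
      by (simp_all add: field_simps)
    ultimately show "(1 - \<epsilon>) / 2 * (norm f)\<^sup>2 \<le> H f" "H f \<le> (1 + \<epsilon>) / 2 * (norm f)\<^sup>2"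
      by (simp_all only:)
  qed
  define c where "c = sqrt ((1 + \<epsilon>) / (1 - \<epsilon>)) * exp (- r * t)"
  have c0: "c \<ge> 0"
    using \<epsilon> by (simp add: c_def)
  have on_domain: "norm (U t f) \<le> c * norm f" if f: "f \<in> Domain (semigroup_generator U)" for f
  proof -
    from f obtain g where fg: "(f, g) \<in> semigroup_generator U" by blast
    \<comment> \<open>The upper bound on \<open>H\<close> turns the assumed dissipation into at
      least \<open>2 * r * H\<close>, hence the exponent \<open>2 * r * s\<close>.\<close>
    define \<phi> where "\<phi> s = exp (2 * r * s) * H (U s f)" for s
    have cont: "continuous_on {0..t} (\<lambda>s. U s f)"
      using semigroup_continuous[OF U] by (rule continuous_on_subset) auto
    have "\<phi> t \<le> \<phi> 0"
    proof (rule DERIV_nonpos_imp_decreasing_open[OF t])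
      show "continuous_on {0..t} \<phi>"
        unfolding \<phi>_def H_def
        by (intro continuous_intros cont bounded_linear.continuous_on[OF A]) simp
    next
      fix s :: real assume s: "0 < s" "s < t"
      define F where "F = (\<lambda>s. U s f)"
      have "s \<in> interior {0..}" using s by simp
      then have "(F has_vector_derivative U s g) (at s)"
        using semigroup_has_vector_derivative[OF U fg, of s] s
        unfolding F_def by (simp only: at_within_interior)
      moreover from bounded_linear.has_vector_derivative[OF A this]
      have "((\<lambda>s. A (F s)) has_vector_derivative A (U s g)) (at s)" .
      moreover have fg': "(F s, U s g) \<in> semigroup_generator U"
        unfolding F_def using semigroup_generator_invariant[OF U fg] s by simp
      ultimately have "(\<phi> has_real_derivative
          2 * r * exp (2 * r * s) * H (F s) + exp (2 * r * s) *
            (U s g \<bullet> F s + \<epsilon> * (A (U s g) \<bullet> F s + A (F s) \<bullet> U s g))) (at s)"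
        unfolding \<phi>_def H_def F_def[symmetric] power2_norm_eq_inner
        unfolding has_vector_derivative_def has_field_derivative_def
        by (auto intro!: derivative_eq_intros simp: F_def inner_commute field_simps fun_eq_iff)
      moreover have "2 * r * exp (2 * r * s) * H (F s) + exp (2 * r * s) *
            (U s g \<bullet> F s + \<epsilon> * (A (U s g) \<bullet> F s + A (F s) \<bullet> U s g)) \<le> 0"
      proof -
        have "2 * r * H (F s) \<le> 2 * r * ((1 + \<epsilon>) / 2 * (norm (F s))\<^sup>2)"
          using H_bounds r by (intro mult_left_mono) auto
        with dissipation[OF fg']
        have "2 * r * H (F s) + (U s g \<bullet> F s + \<epsilon> * (A (U s g) \<bullet> F s + A (F s) \<bullet> U s g)) \<le> 0"
          by simp
        then have "exp (2 * r * s) * (2 * r * H (F s) +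
            (U s g \<bullet> F s + \<epsilon> * (A (U s g) \<bullet> F s + A (F s) \<bullet> U s g))) \<le> 0"
          by (simp add: mult_le_0_iff)
        then show ?thesis by (simp add: algebra_simps)
      qed
      ultimately show "\<exists>y. (\<phi> has_real_derivative y) (at s) \<and> y \<le> 0" by blast
    qed
    then have "H (U t f) \<le> exp (- (2 * r * t)) * H f"
      by (simp add: \<phi>_def semigroup_zero[OF U] exp_minus field_simps)
    also have "\<dots> \<le> exp (- (2 * r * t)) * ((1 + \<epsilon>) / 2 * (norm f)\<^sup>2)"
      using H_bounds by (intro mult_left_mono) auto
    finally have "(1 - \<epsilon>) / 2 * (norm (U t f))\<^sup>2 \<le> exp (- (2 * r * t)) * ((1 + \<epsilon>) / 2 * (norm f)\<^sup>2)"
      using H_bounds(1) order_trans by blast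
    then have "(norm (U t f))\<^sup>2 \<le> (1 + \<epsilon>) / (1 - \<epsilon>) * exp (- (2 * r * t)) * (norm f)\<^sup>2"
      using \<epsilon> by (simp add: field_simps)
    also have "\<dots> = (c * norm f)\<^sup>2"
      using \<epsilon> by (simp add: c_def power_mult_distrib flip: exp_of_nat_mult)
    finally show ?thesis
      by (rule power2_le_imp_le) (simp add: c0)
  qed
  \<comment> \<open>For fixed \<open>t\<close> the estimate is a closed condition on
    \<open>f\<close>, so it extends from the dense domain of the generator.\<close>
  have "closed {f. norm (U t f) \<le> c * norm f}"
    using t by (intro closed_Collect_le continuous_intros
        bounded_linear.continuous_on[OF semigroup_bounded_linear[OF U]])
  then have "closure (Domain (semigroup_generator U)) \<subseteq> {f. norm (U t f) \<le> c * norm f}"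
    using on_domain by (intro closure_minimal) auto
  then show ?thesis
    using semigroup_generator_dense[OF U] by (auto simp: densely_defined_def c_def)
qed

subsection \<open>The operator \<open>A\<close>\<close>

text \<open>The graph of \<open>Z\<close> is closed, and density of the domain of \<open>R\<close>
  lets points of \<open>R\<close> approximate each of its points.\<close>

lemma bounded_ext_eq_fun_oper:
  assumes Z: "continuous_on UNIV Z" and R: "R \<subseteq> fun_oper Z" "densely_defined R"
  shows "bounded_ext R = fun_oper (Z :: 'a::real_normed_vector \<Rightarrow> 'a)"
proof
  have "fun_oper Z = {x. snd x = Z (fst x)}"
    by (auto simp: fun_oper_def)
  moreover have "closed {x. snd x = Z (fst x)}"
    by (intro closed_Collect_eq continuous_intros continuous_on_compose2[OF Z]) auto
  ultimately show "bounded_ext R \<subseteq> fun_oper Z"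
    unfolding bounded_ext_def using R(1) by (simp add: closure_minimal)
  show "fun_oper Z \<subseteq> bounded_ext R"
  proof
    fix x assume "x \<in> fun_oper Z"
    then obtain f where x: "x = (f, Z f)" by (auto simp: fun_oper_def)
    have "f \<in> closure (Domain R)" using R(2) by (simp add: densely_defined_def)
    then obtain s where s: "\<And>n. s n \<in> Domain R" "s \<longlonglongrightarrow> f"
      by (auto simp: closure_sequential)
    have "(s n, Z (s n)) \<in> R" for n
      using s(1)[of n] R(1) by (auto simp: fun_oper_def)
    moreover have "(\<lambda>n. (s n, Z (s n))) \<longlonglongrightarrow> (f, Z f)"
      using s(2) by (intro tendsto_Pair continuous_on_tendsto_compose[OF Z]) auto
    ultimately show "x \<in> bounded_ext R"
      unfolding bounded_ext_def closure_sequential x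
      by (intro exI[of _ "\<lambda>n. (s n, Z (s n))"]) simp
  qed
qed

text \<open>Only \<open>T\<close> and the projection enter here; \<open>V\<close> stands for the
  null space of \<open>L\<close>.\<close>

locale macroscopic_setting =
  fixes T :: "'a::{real_inner, complete_space} oper" and P :: "'a \<Rightarrow> 'a" and V :: "'a set"
  assumes T: "subspace T" "closed T" and T_skew: "skew_symmetric_oper T"
    and T_dense: "densely_defined T"
    and P: "orthogonal_projection P V" and V: "subspace V"
begin

sublocale P: bounded_linear P
  using P V by (rule bounded_linear_projection)

lemmas P_idem [simp] = projection_idem[OF P V]

definition S :: "'a oper" where "S = T \<circ>\<^sub>o fun_oper P"

lemma mem_S: "(f, u) \<in> S \<longleftrightarrow> (P f, u) \<in> T"
  by (auto simp: S_def oper_comp_def fun_oper_def)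

lemma S_eq_vimage: "S = (\<lambda>x. (P (fst x), snd x)) -` T"
  by (auto simp: mem_S)

lemma subspace_S: "subspace S"
proof -
  have "linear (\<lambda>x :: 'a \<times> 'a. (P (fst x), snd x))"
    by (rule linearI) (simp_all add: P.add P.scaleR)
  from linear_subspace_vimage[OF this T(1)] show ?thesis
    by (simp only: S_eq_vimage)
qed

lemma closed_S: "closed S"
  unfolding S_eq_vimage
  by (intro closed_vimage T(2) continuous_intros P.continuous_on)

text \<open>Von Neumann's device: \<open>1 + S\<^sup>*S\<close> is inverted by projecting onto the
  graph of \<open>S\<close>, a closed subspace of the product space.\<close>

definition proj_S :: "'a \<times> 'a \<Rightarrow> 'a \<times> 'a" where
  "proj_S = (SOME p. orthogonal_projection p S)"

lemma proj_S: "orthogonal_projection proj_S S"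
  unfolding proj_S_def
  using orthogonal_projection_exists[OF subspace_S closed_S] by (rule someI_ex)

lemmas bounded_linear_proj_S = bounded_linear_projection[OF proj_S subspace_S]

text \<open>
  The equation \<open>(1 + S\<^sup>*S) u = S\<^sup>*g\<close> says that \<open>(u, S u)\<close> is the orthogonal projection of
  \<open>(0, g)\<close> onto the graph of \<open>S\<close>, and this makes sense for every \<open>g\<close>.
\<close>

definition A :: "'a \<Rightarrow> 'a" where "A g = fst (proj_S (0, g))"

definition SA :: "'a \<Rightarrow> 'a" where "SA g = snd (proj_S (0, g))"

lemma bounded_linear_A: "bounded_linear A"
  unfolding A_def
  by (intro bounded_linear_compose[OF bounded_linear_fst]
      bounded_linear_compose[OF bounded_linear_proj_S]
      bounded_linear_Pair bounded_linear_zero bounded_linear_ident)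

lemma SA: "(A g, SA g) \<in> S"
  using projection_in[OF proj_S subspace_S] by (simp add: A_def SA_def)

text \<open>The weak form of \<open>(1 + S\<^sup>*S) (A g) = S\<^sup>*g\<close>, tested against the
  graph of \<open>S\<close>; it avoids any question about the domain of the adjoint.\<close>

lemma A_equation:
  assumes "(h, k) \<in> S"
  shows "A g \<bullet> h + SA g \<bullet> k = g \<bullet> k"
  using projection_orthogonal[OF proj_S subspace_S assms, of "(0, g)"]
  by (simp add: inner_prod_def A_def SA_def inner_diff_left)

lemma A_eqI:
  assumes "(u, v) \<in> S" "\<And>h k. (h, k) \<in> S \<Longrightarrow> u \<bullet> h + v \<bullet> k = g \<bullet> k"
  shows "A g = u"
proof -
  have "proj_S (0, g) = (u, v)"
    using assms by (intro projection_unique[OF proj_S subspace_S])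
      (auto simp: inner_prod_def inner_diff_left algebra_simps)
  then show ?thesis by (simp add: A_def)
qed

text \<open>On the domain of \<open>S\<^sup>*\<close> the operator formula satisfies the weak
  equation, whose solution is unique. That domain contains the dense domain of \<open>T\<close>, so
  the extension is \<open>A\<close>.\<close>

lemma hypo_A_eq: "hypo_A T P = fun_oper A"
proof -
  let ?A = "(Id +\<^sub>o adjoint_oper S \<circ>\<^sub>o S)\<inverse> \<circ>\<^sub>o adjoint_oper S"
  have mem: "(g, u) \<in> ?A \<longleftrightarrow>
      (\<exists>v y. (g, u + y) \<in> adjoint_oper S \<and> (u, v) \<in> S \<and> (v, y) \<in> adjoint_oper S)" for g u
    by (auto simp: oper_comp_def oper_add_def)
  have "?A \<subseteq> fun_oper A"
  proof (rule subrelI)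
    fix g u assume "(g, u) \<in> ?A"
    then obtain v y where y: "(g, u + y) \<in> adjoint_oper S" "(u, v) \<in> S" "(v, y) \<in> adjoint_oper S"
      unfolding mem by blast
    have "A g = u"
    proof (rule A_eqI[OF y(2)])
      fix h k assume "(h, k) \<in> S"
      with y(1,3) have "k \<bullet> g = h \<bullet> (u + y)" "k \<bullet> v = h \<bullet> y"
        by (auto simp: adjoint_oper_def)
      then show "u \<bullet> h + v \<bullet> k = g \<bullet> k"
        by (simp add: inner_commute inner_add_right)
    qed
    then show "(g, u) \<in> fun_oper A" by (simp add: fun_oper_def)
  qed
  moreover have "Domain (adjoint_oper S) \<subseteq> Domain ?A"
  proof
    fix g assume "g \<in> Domain (adjoint_oper S)"
    then obtain q where q: "(g, q) \<in> adjoint_oper S" by blast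
    \<comment> \<open>The weak equation read strongly: \<open>S\<^sup>*\<close> sends
      \<open>SA g\<close> to \<open>S\<^sup>*g - A g\<close>.\<close>
    have "(SA g, q - A g) \<in> adjoint_oper S"
      using q A_equation[of _ _ g]
      by (fastforce simp: adjoint_oper_def inner_diff_right inner_commute algebra_simps)
    then have "(g, A g) \<in> ?A"
      unfolding mem using q SA[of g] by (intro exI[of _ "SA g"] exI[of _ "q - A g"]) simp
    then show "g \<in> Domain ?A" by blast
  qed
  moreover have "Domain T \<subseteq> Domain (adjoint_oper S)"
  proof
    fix g assume "g \<in> Domain T"
    then obtain w where w: "(g, w) \<in> T" by blast
    \<comment> \<open>Skew symmetry makes the adjoint of \<open>T \<Pi>\<close> an extension of
      \<open>- \<Pi> T\<close>.\<close>
    have "(g, - P w) \<in> adjoint_oper S"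
      using T_skew w projection_selfadjoint[OF P V]
      by (fastforce simp: adjoint_oper_def mem_S skew_symmetric_oper_def)
    then show "g \<in> Domain (adjoint_oper S)" by blast
  qed
  then have "closure (Domain T) \<subseteq> closure (Domain ?A)"
    using calculation by (intro closure_mono) blast
  then have "densely_defined ?A"
    using T_dense by (auto simp: densely_defined_def)
  ultimately have "bounded_ext ?A = fun_oper A"
    by (intro bounded_ext_eq_fun_oper linear_continuous_on bounded_linear_A)
  then show ?thesis
    by (simp add: hypo_A_def S_def Let_def)
qed

text \<open>\<open>S\<close> sends \<open>(1 - \<Pi>) (A g)\<close> to \<open>0\<close>, so the weak
  equation tested with it shows that this component vanishes.\<close>

lemma P_A [simp]: "P (A g) = A g"
proof -
  have "(A g - P (A g), 0) \<in> S"
    using subspace_0[OF T(1)] by (simp add: mem_S P.diff zero_prod_def)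
  then have "A g \<bullet> (A g - P (A g)) = 0"
    using A_equation by fastforce
  moreover have "(A g - P (A g)) \<bullet> P (A g) = 0"
    by (rule projection_orthogonal[OF P V projection_in[OF P V]])
  ultimately have "(A g - P (A g)) \<bullet> (A g - P (A g)) = 0"
    by (simp add: inner_diff_left inner_diff_right inner_commute)
  then show ?thesis by simp
qed

lemma TA: "(A g, SA g) \<in> T"
  using SA[of g] by (simp add: mem_S)

lemma inner_A: "A g \<bullet> f = A g \<bullet> P f"
  by (metis P_A projection_selfadjoint[OF P V])

section \<open>Bounds on \<open>A\<close> and \<open>T A\<close> from
  \<open>\<Pi> T \<Pi> = 0\<close>\<close>

context
  assumes PTP: "\<And>f u. (f, u) \<in> S \<Longrightarrow> P u = 0"
begin

lemma inner_S_micro: "(h, k) \<in> S \<Longrightarrow> g \<bullet> k = (g - P g) \<bullet> k"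
  by (simp add: inner_diff_left projection_selfadjoint[OF P V] PTP)

text \<open>The weak equation tested with its own solution; only the microscopic part of
  \<open>g\<close> survives because \<open>SA g\<close> has no macroscopic part.\<close>

lemma A_energy: "(norm (A g))\<^sup>2 + (norm (SA g))\<^sup>2 = (g - P g) \<bullet> SA g"
  using A_equation[OF SA, of g g] inner_S_micro[OF SA, of g g] by (simp add: power2_norm_eq_inner)

text \<open>Since \<open>SA g\<close> is \<open>T (A g)\<close>, this is the bound on
  \<open>T A\<close> needed in the entropy dissipation.\<close>

lemma norm_SA_le: "norm (SA g) \<le> norm (g - P g)"
proof -
  have "norm (SA g) * norm (SA g) \<le> (g - P g) \<bullet> SA g"
    using A_energy[of g] zero_le_power2[of "norm (A g)"] unfolding power2_eq_square by linarith
  also have "\<dots> \<le> norm (g - P g) * norm (SA g)"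
    by (rule norm_cauchy_schwarz)
  finally show ?thesis by (cases "SA g = 0") simp_all
qed

lemma norm_A_le: "norm (A g) \<le> norm g / 2"
proof -
  have "(norm (A g))\<^sup>2 + (norm (SA g))\<^sup>2 \<le> norm (g - P g) * norm (SA g)"
    using A_energy[of g] norm_cauchy_schwarz[of "g - P g" "SA g"] by simp
  \<comment> \<open>Completing the square in \<open>norm (SA g)\<close> produces the factor
    \<open>1 / 2\<close>, which makes the entropy equivalent to the squared norm for every
    \<open>\<epsilon> < 1\<close>.\<close>
  moreover have "0 \<le> (norm (g - P g) / 2 - norm (SA g))\<^sup>2" by simp
  ultimately have "(norm (A g))\<^sup>2 \<le> (norm (g - P g) / 2)\<^sup>2"
    by (simp add: power2_diff power_divide)
  then have "norm (A g) \<le> norm (g - P g) / 2"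
    by (rule power2_le_imp_le) simp
  moreover have "norm (g - P g) \<le> norm g"
    using projection_pythagoras[OF P V, of g] by (simp add: power2_le_imp_le[of "norm (g - P g)"])
  ultimately show ?thesis by simp
qed

lemma abs_inner_A_le: "\<bar>A f \<bullet> f\<bar> \<le> (norm f)\<^sup>2 / 2"
proof -
  have "\<bar>A f \<bullet> f\<bar> \<le> norm (A f) * norm f"
    by (rule Cauchy_Schwarz_ineq2)
  also have "\<dots> \<le> norm f / 2 * norm f"
    using norm_A_le by (rule mult_right_mono) simp
  finally show ?thesis by (simp add: power2_eq_square)
qed

end

section \<open>Coercivity of \<open>A T \<Pi>\<close>\<close>

context
  fixes lM :: real
  assumes lM: "lM > 0"
    and macro: "\<And>f u. (f, u) \<in> S \<Longrightarrow> lM * (norm (P f))\<^sup>2 \<le> (norm u)\<^sup>2"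
    and S_dense: "densely_defined S"
begin

text \<open>
  If \<open>u = S f\<close> then \<open>w = \<Pi> f - A u\<close> solves \<open>(1 + S\<^sup>*S) w = \<Pi> f\<close>, so that \<open>(w, S w)\<close> is the
  projection of \<open>(\<Pi> f, 0)\<close> onto the graph of \<open>S\<close>.
\<close>

lemma proj_S_macro:
  assumes fu: "(f, u) \<in> S"
  shows "proj_S (P f, 0) = (P f - A u, u - SA u)"
proof (rule projection_unique[OF proj_S subspace_S])
  have "(P f, u) \<in> S" using fu by (simp add: mem_S)
  from subspace_diff[OF subspace_S this SA[of u]]
  show "(P f - A u, u - SA u) \<in> S" by simp
next
  fix x assume "x \<in> S"
  then show "((P f, 0) - (P f - A u, u - SA u)) \<bullet> x = 0"
    using A_equation[of "fst x" "snd x" u] by (simp add: inner_prod_def inner_diff_left)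
qed

text \<open>On the range of \<open>\<Pi>\<close>,
  \<open>A S = 1 - (1 + S\<^sup>*S)\<^sup>-\<^sup>1\<close>, and macroscopic coercivity bounds the
  inverse by \<open>1 / (1 + lM)\<close>. Here \<open>w\<close> is that inverse applied to
  \<open>P f\<close>.\<close>

lemma A_S_coercive:
  assumes fu: "(f, u) \<in> S"
  shows "lM / (1 + lM) * (norm (P f))\<^sup>2 \<le> A u \<bullet> f"
proof -
  define w where "w = P f - A u"
  define k where "k = u - SA u"
  have wk: "proj_S (P f, 0) = (w, k)"
    using proj_S_macro[OF fu] by (simp add: w_def k_def)
  have S: "(w, k) \<in> S"
    using projection_in[OF proj_S subspace_S, of "(P f, 0)"] by (simp add: wk)
  have Pw: "P w = w" by (simp add: w_def P.diff)
  have "(norm w)\<^sup>2 + (norm k)\<^sup>2 = P f \<bullet> w"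
    using projection_orthogonal[OF proj_S subspace_S S, of "(P f, 0)"]
    by (simp add: wk inner_prod_def inner_diff_left power2_norm_eq_inner)
  then have "(1 + lM) * (norm w)\<^sup>2 \<le> P f \<bullet> w"
    using macro[OF S] by (simp add: Pw distrib_right)
  also have "\<dots> \<le> norm (P f) * norm w" by (rule norm_cauchy_schwarz)
  finally have "(1 + lM) * norm w \<le> norm (P f)"
    by (cases "w = 0") (simp_all add: power2_eq_square)
  then have "norm w \<le> norm (P f) / (1 + lM)"
    using lM by (simp add: field_simps)
  then have "norm (P f) * norm w \<le> norm (P f) * (norm (P f) / (1 + lM))"
    by (rule mult_left_mono) simp
  with norm_cauchy_schwarz[of "P f" w] have "P f \<bullet> w \<le> (norm (P f))\<^sup>2 / (1 + lM)"
    by (simp add: power2_eq_square)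
  moreover have "A u \<bullet> f = (norm (P f))\<^sup>2 - P f \<bullet> w"
    unfolding inner_A[of u f]
    by (simp add: w_def inner_diff_right power2_norm_eq_inner inner_commute)
  moreover have "lM / (1 + lM) * (norm (P f))\<^sup>2 = (norm (P f))\<^sup>2 - (norm (P f))\<^sup>2 / (1 + lM)"
    using lM by (simp add: field_simps)
  ultimately show ?thesis by linarith
qed

text \<open>The formula for \<open>A S f\<close> through the projection of \<open>(P f, 0)\<close>
  makes sense for every \<open>f\<close>, even if \<open>P f\<close> is outside the domain of
  \<open>T\<close>.\<close>

lemma bounded_ext_A_S:
  "\<exists>Z. bounded_ext (hypo_A T P \<circ>\<^sub>o T \<circ>\<^sub>o fun_oper P) = fun_oper Z \<and>
    (\<forall>f. lM / (1 + lM) * (norm (P f))\<^sup>2 \<le> Z f \<bullet> f \<and> P (Z f) = Z f)"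
proof -
  define R where "R = hypo_A T P \<circ>\<^sub>o T \<circ>\<^sub>o fun_oper P"
  define Z where "Z f = P f - fst (proj_S (P f, 0))" for f
  have R: "R = {(f, A u) | f u. (f, u) \<in> S}"
    unfolding R_def S_def[symmetric] by (auto simp: hypo_A_eq oper_comp_def fun_oper_def)
  have ext: "bounded_ext R = fun_oper Z"
  proof (rule bounded_ext_eq_fun_oper)
    show "continuous_on UNIV Z"
      unfolding Z_def
      by (intro continuous_intros P.continuous_on
          bounded_linear.continuous_on[OF bounded_linear_proj_S])
    show "R \<subseteq> fun_oper Z"
      by (auto simp: R fun_oper_def Z_def proj_S_macro)
    have "Domain R = Domain S"
      by (auto simp: R Domain_iff)
    then show "densely_defined R"
      using S_dense by (simp add: densely_defined_def)
  qed
  \<comment> \<open>Both properties are closed conditions on pairs, hence pass from the graph of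
    \<open>A S\<close> to its closure.\<close>
  define C where "C = {x. lM / (1 + lM) * (norm (P (fst x)))\<^sup>2 \<le> snd x \<bullet> fst x \<and> P (snd x) = snd x}"
  have "closed C"
    unfolding C_def
    by (intro closed_Collect_conj closed_Collect_le closed_Collect_eq continuous_intros P.continuous_on)
  moreover have "R \<subseteq> C"
    using A_S_coercive by (auto simp: R C_def)
  ultimately have "bounded_ext R \<subseteq> C"
    by (simp add: bounded_ext_def closure_minimal)
  moreover have "(f, Z f) \<in> bounded_ext R" for f
    by (simp add: ext fun_oper_def)
  ultimately have "(f, Z f) \<in> C" for f by blast
  with ext show ?thesis
    unfolding R_def C_def by (intro exI[of _ Z]) simp
qed

end

end

section \<open>Choice of the constants\<close>

text \<open>Here \<open>a\<close> and \<open>b\<close> are the norms of the microscopic and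
  macroscopic parts. The cross term uses part of \<open>\<mu> * b\<^sup>2\<close>, and
  \<open>\<epsilon>\<close> is so small that \<open>lm * a\<^sup>2\<close> absorbs every term in
  \<open>a\<^sup>2\<close>.\<close>

lemma hypo_constants:
  fixes lm lM CM :: real
  assumes "lm > 0" "lM > 0" "CM > 0"
  defines "\<mu> \<equiv> lM / (1 + lM)" and "\<epsilon> \<equiv> hypo_eps lm lM CM"
  shows "0 < \<epsilon>" "\<epsilon> < 1" "0 < hypo_rate lm lM CM" "0 < hypo_const lm lM CM"
    and "- lm * a\<^sup>2 + \<epsilon> * (CM * (a * b) - \<mu> * b\<^sup>2 + a\<^sup>2)
      \<le> - (hypo_rate lm lM CM * (1 + \<epsilon>) * (a\<^sup>2 + b\<^sup>2))"
proof -
  have \<mu>: "0 < \<mu>" "\<mu> < 1"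
    using assms(2) by (simp_all add: \<mu>_def)
  have \<epsilon>: "\<epsilon> = min (1 / 2) (lm * \<mu> / (2 * \<mu> + CM\<^sup>2))"
    by (simp add: \<epsilon>_def hypo_eps_def \<mu>_def Let_def)
  have den: "2 * \<mu> + CM\<^sup>2 > 0" using \<mu>(1) by (simp add: add_pos_nonneg)
  show pos: "0 < \<epsilon>" and lt1: "\<epsilon> < 1"
    using \<epsilon> den \<mu>(1) assms(1) by auto
  show "0 < hypo_rate lm lM CM" "0 < hypo_const lm lM CM"
    using pos lt1 \<mu> by (simp_all add: hypo_rate_def hypo_const_def Let_def flip: \<epsilon>_def \<mu>_def)
  have rate: "hypo_rate lm lM CM * (1 + \<epsilon>) = \<epsilon> * \<mu> / 2"
    using pos by (simp add: hypo_rate_def Let_def field_simps flip: \<epsilon>_def \<mu>_def)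
  have "\<epsilon> \<le> lm * \<mu> / (2 * \<mu> + CM\<^sup>2)" using \<epsilon> by simp
  then have "\<epsilon> * (2 * \<mu> + CM\<^sup>2) \<le> lm * \<mu>"
    using den by (simp add: pos_le_divide_eq)
  then have "\<epsilon> * (2 + CM\<^sup>2 / \<mu>) \<le> lm"
    using \<mu>(1) by (simp add: field_simps)
  then have "\<epsilon> * (2 + CM\<^sup>2 / \<mu>) * a\<^sup>2 \<le> lm * a\<^sup>2"
    by (rule mult_right_mono) simp
  moreover have "CM * (a * b) \<le> \<mu> * b\<^sup>2 / 2 + CM\<^sup>2 / \<mu> * a\<^sup>2 / 2"
  proof -
    \<comment> \<open>The weights in Young's inequality are chosen to spend exactly half of
      \<open>\<mu> * b\<^sup>2\<close>; the other half gives the decay.\<close>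
    have "0 \<le> (\<mu> * b - CM * a)\<^sup>2 / (2 * \<mu>)" using \<mu>(1) by simp
    also have "\<dots> = \<mu> * b\<^sup>2 / 2 + CM\<^sup>2 / \<mu> * a\<^sup>2 / 2 - CM * (a * b)"
      using \<mu>(1) by (simp add: field_simps power2_eq_square)
    finally show ?thesis by simp
  qed
  moreover have "\<mu> * a\<^sup>2 / 2 \<le> a\<^sup>2"
    using \<mu> mult_right_mono[of "\<mu> / 2" 1 "a\<^sup>2"] by simp
  moreover have "0 \<le> CM\<^sup>2 / \<mu> * a\<^sup>2" using \<mu>(1) by simp
  ultimately have "CM * (a * b) - \<mu> * b\<^sup>2 + a\<^sup>2 + \<mu> / 2 * (a\<^sup>2 + b\<^sup>2) \<le> (2 + CM\<^sup>2 / \<mu>) * a\<^sup>2"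
    by (simp add: algebra_simps)
  then have "\<epsilon> * (CM * (a * b) - \<mu> * b\<^sup>2 + a\<^sup>2 + \<mu> / 2 * (a\<^sup>2 + b\<^sup>2)) \<le> \<epsilon> * ((2 + CM\<^sup>2 / \<mu>) * a\<^sup>2)"
    using pos by (intro mult_left_mono) auto
  with \<open>\<epsilon> * (2 + CM\<^sup>2 / \<mu>) * a\<^sup>2 \<le> lm * a\<^sup>2\<close>
  show "- lm * a\<^sup>2 + \<epsilon> * (CM * (a * b) - \<mu> * b\<^sup>2 + a\<^sup>2)
      \<le> - (hypo_rate lm lM CM * (1 + \<epsilon>) * (a\<^sup>2 + b\<^sup>2))"
    unfolding rate by (simp add: algebra_simps)
qed

section \<open>Entropy dissipation and exponential decay\<close>

theorem theorem2:
  fixes L T :: "'a::{real_inner, complete_space} oper"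
    and P :: "'a \<Rightarrow> 'a"
    and U :: "real \<Rightarrow> 'a \<Rightarrow> 'a"
    and lm lM CM :: real
  assumes L: "linear_oper L" "closed L"
    and T: "linear_oper T" "closed T"
    and U: "C0_semigroup U" "semigroup_generator U = L -\<^sub>o T"
    and P: "orthogonal_projection P (null_space L)"
    and TP_dense: "densely_defined (T \<circ>\<^sub>o fun_oper P)"
    and constants: "lm > 0" "lM > 0" "CM > 0"
    and L_symmetric: "symmetric_oper L"
    and micro: "\<And>f u. (f, u) \<in> L \<Longrightarrow> - (u \<bullet> f) \<ge> lm * (norm (f - P f))\<^sup>2"
    and T_skew: "skew_symmetric_oper T"
    and macro: "\<And>f u. (f, u) \<in> T \<circ>\<^sub>o fun_oper P \<Longrightarrow> (norm u)\<^sup>2 \<ge> lM * (norm (P f))\<^sup>2"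
    and PTP: "\<And>f u. (f, u) \<in> fun_oper P \<circ>\<^sub>o T \<circ>\<^sub>o fun_oper P \<Longrightarrow> u = 0"
    and bounded: "bounded_oper (hypo_AT_micro T P)" "bounded_oper (hypo_A T P \<circ>\<^sub>o L)"
    and aux: "\<And>f u v. (f, u) \<in> bounded_ext (hypo_AT_micro T P) \<Longrightarrow>
                (f, v) \<in> bounded_ext (hypo_A T P \<circ>\<^sub>o L) \<Longrightarrow>
                norm u + norm v \<le> CM * norm (f - P f)"
  shows "hypo_rate lm lM CM > 0 \<and> hypo_const lm lM CM > 0 \<and>
         (\<forall>fI. \<forall>t\<ge>0. norm (U t fI)
            \<le> hypo_const lm lM CM * exp (- hypo_rate lm lM CM * t) * norm fI)"
proof -
  have V: "subspace (null_space L)"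
  proof (rule subspaceI)
    have L': "subspace L" using L(1) by (simp add: linear_oper_def)
    show "0 \<in> null_space L"
      using subspace_0[OF L'] by (simp add: null_space_def zero_prod_def)
    show "x + y \<in> null_space L" if "x \<in> null_space L" "y \<in> null_space L" for x y
      using subspace_add[OF L', of "(x, 0)" "(y, 0)"] that by (simp add: null_space_def)
    show "c *\<^sub>R x \<in> null_space L" if "x \<in> null_space L" for c x
      using subspace_scale[OF L', of "(x, 0)" c] that by (simp add: null_space_def)
  qed
  \<comment> \<open>Density of the domain of \<open>T\<close> is inherited from that of the
    generator.\<close>
  have "Domain (semigroup_generator U) \<subseteq> Domain T"
    by (auto simp: U(2) oper_diff_def)
  from closure_mono[OF this] have T_dense: "densely_defined T"
    using semigroup_generator_dense[OF U(1)] by (auto simp: densely_defined_def)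
  interpret macroscopic_setting T P "null_space L"
    using T T_skew T_dense P V by unfold_locales (auto simp: linear_oper_def)
  have PS: "P u = 0" if "(f, u) \<in> S" for f u
    using PTP[of f "P u"] that by (auto simp: S_def oper_comp_def fun_oper_def)
  note A_le = abs_inner_A_le[OF PS] and SA_le = norm_SA_le[OF PS]
  obtain Z where ext: "bounded_ext (hypo_A T P \<circ>\<^sub>o T \<circ>\<^sub>o fun_oper P) = fun_oper Z"
    and Z: "\<And>f. lM / (1 + lM) * (norm (P f))\<^sup>2 \<le> Z f \<bullet> f" "\<And>f. P (Z f) = Z f"
    using bounded_ext_A_S[OF constants(2), folded S_def] macro TP_dense
    unfolding S_def by metis
  define \<epsilon> where "\<epsilon> = hypo_eps lm lM CM"
  define r where "r = hypo_rate lm lM CM"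
  note const = hypo_constants[OF constants, folded \<epsilon>_def r_def]
  interpret A: bounded_linear A by (rule bounded_linear_A)
  have dissipation: "g \<bullet> f + \<epsilon> * (A g \<bullet> f + A f \<bullet> g) \<le> - (r * (1 + \<epsilon>) * (norm f)\<^sup>2)"
    if fg: "(f, g) \<in> semigroup_generator U" for f g
  proof -
    from fg obtain l \<tau> where g: "g = l - \<tau>" and l: "(f, l) \<in> L" and \<tau>: "(f, \<tau>) \<in> T"
      by (auto simp: U(2) oper_diff_def)
    define a where "a = norm (f - P f)"
    define b where "b = norm (P f)"
    \<comment> \<open>\<open>Z f\<close> is the extended \<open>A T \<Pi> f\<close>, so
      \<open>u\<close> is \<open>A T (1 - \<Pi>) f\<close> in the sense of
      \<open>hypo_AT_micro\<close>, whether or not \<open>P f\<close> lies in the domain of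
      \<open>T\<close>.\<close>
    define u where "u = A \<tau> - Z f"
    have "(f, u) \<in> hypo_AT_micro T P"
      unfolding hypo_AT_micro_def ext using \<tau>
      by (auto simp: hypo_A_eq oper_comp_def oper_diff_def fun_oper_def u_def)
    moreover have "(f, A l) \<in> hypo_A T P \<circ>\<^sub>o L"
      using l by (auto simp: hypo_A_eq oper_comp_def fun_oper_def)
    ultimately have "norm u + norm (A l) \<le> CM * a"
      unfolding a_def bounded_ext_def[symmetric]
      by (intro aux) (auto simp: bounded_ext_def intro: subsetD[OF closure_subset])
    \<comment> \<open>Both \<open>u\<close> and \<open>A l\<close> lie in the range of
      \<open>\<Pi>\<close>, so they only pair with \<open>P f\<close>; this yields the product
      \<open>a * b\<close>.\<close>
    then have "(norm u + norm (A l)) * b \<le> CM * a * b"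
      by (rule mult_right_mono) (simp add: b_def)
    moreover have "A l \<bullet> f \<le> norm (A l) * b"
      unfolding b_def inner_A[of l f] by (rule norm_cauchy_schwarz)
    moreover have "- (u \<bullet> f) \<le> norm u * b"
    proof -
      have "u \<bullet> f = u \<bullet> P f"
        using projection_selfadjoint[OF P V, of u f] by (simp add: u_def P.diff Z(2))
      then show ?thesis
        using norm_cauchy_schwarz[of "- u" "P f"] by (simp add: b_def)
    qed
    ultimately have mixed: "A l \<bullet> f - u \<bullet> f \<le> CM * (a * b)"
      by (simp add: algebra_simps)
    \<comment> \<open>\<open>A\<close> maps into the null space of \<open>L\<close>, so symmetry of
      \<open>L\<close> removes \<open>A f \<bullet> l\<close>.\<close>
    have "(A f, 0) \<in> L"
      using projection_in[OF P V, of "A f"] by (simp add: null_space_def)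
    then have Lf: "A f \<bullet> l = 0"
      using L_symmetric l by (fastforce simp: symmetric_oper_def inner_commute)
    \<comment> \<open>Skew symmetry moves \<open>T\<close> from \<open>f\<close> onto
      \<open>A f\<close>, where \<open>SA f\<close> is its value and is purely microscopic.\<close>
    have "- (A f \<bullet> \<tau>) = SA f \<bullet> f"
      using T_skew TA[of f] \<tau> by (fastforce simp: skew_symmetric_oper_def)
    also have "\<dots> \<le> a\<^sup>2"
    proof -
      have "SA f \<bullet> f = (f - P f) \<bullet> SA f"
        using inner_S_micro[OF PS SA, where g = f] by (simp only: inner_commute)
      also have "\<dots> \<le> a * norm (SA f)"
        unfolding a_def by (rule norm_cauchy_schwarz)
      also have "\<dots> \<le> a * a"
        using SA_le by (intro mult_left_mono) (auto simp: a_def)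
      finally show ?thesis by (simp add: power2_eq_square)
    qed
    finally have Tf: "- (A f \<bullet> \<tau>) \<le> a\<^sup>2" .
    have "A g \<bullet> f + A f \<bullet> g = (A l \<bullet> f - u \<bullet> f) - Z f \<bullet> f + - (A f \<bullet> \<tau>)"
      by (simp add: g u_def A.diff Lf inner_diff_left inner_diff_right)
    also have "\<dots> \<le> CM * (a * b) - lM / (1 + lM) * b\<^sup>2 + a\<^sup>2"
      using mixed Z(1)[of f] Tf by (simp add: b_def)
    finally have "\<epsilon> * (A g \<bullet> f + A f \<bullet> g) \<le> \<epsilon> * (CM * (a * b) - lM / (1 + lM) * b\<^sup>2 + a\<^sup>2)"
      using const(1) by (intro mult_left_mono) auto
    \<comment> \<open>Transport conserves the norm, so only \<open>L\<close> contributes to the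
      dissipation of the unmodified part of the entropy.\<close>
    moreover have "\<tau> \<bullet> f = 0"
    proof -
      have "\<tau> \<bullet> f = - (f \<bullet> \<tau>)"
        using T_skew \<tau> by (fastforce simp: skew_symmetric_oper_def)
      then show ?thesis by (simp add: inner_commute)
    qed
    then have "g \<bullet> f \<le> - lm * a\<^sup>2"
      using micro[OF l] by (simp add: g inner_diff_left a_def)
    moreover have "(norm f)\<^sup>2 = a\<^sup>2 + b\<^sup>2"
      using projection_pythagoras[OF P V, of f] by (simp add: a_def b_def)
    ultimately show ?thesis
      using const(5)[of a b] by simp
  qed
  have "norm (U t f) \<le> hypo_const lm lM CM * exp (- r * t) * norm f" if "t \<ge> 0" for t f
    using semigroup_entropy_decay[OF U(1) bounded_linear_A _ const(2) A_le _ dissipation that]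
      const(1,3) by (simp add: hypo_const_def Let_def \<epsilon>_def)
  then show ?thesis
    using const(3,4) by (simp add: r_def)
qed

end
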